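(* Let $\Phi=\{\varphi_1,\dots,\varphi_n\}$ be a finite set of $\mathrm{LTL}_f$ properties over atomic propositions $\mathcal{X}\cup\mathcal{Y}$, with multi-property arena $\mathcal{G}^\times=(2^{\mathcal{X}\cup\mathcal{Y}},S^\times,s_0^\times,\delta^\times)$. Define relations $\mathrm{WinM}_i\subseteq S^\times\times 2^{\Phi}$ by $$\mathrm{WinM}_0:=\{(s,C)\mid s\models C\},\qquad \mathrm{WinM}_{i+1}:=\mathrm{WinM}_i\cup \mathrm{PreMC}(\mathrm{WinM}_i),$$ and let $\mathrm{WinM}:=\bigcup_{i\ge 0}\mathrm{WinM}_i$. Then for all $s\in S^\times$ and all $C\subseteq\Phi$, $$(s,C)\in \mathrm{WinM}\quad\Longleftrightarrow\quad C\text{ is realizable from } s.$$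
   Context: Setting. The finite set of atomic propositions $\mathsf{AP}=\mathcal{X}\cup\mathcal{Y}$ is partitioned into disjoint sets $\mathcal{X}$ (inputs, controlled by the environment) and $\mathcal{Y}$ (outputs, controlled by the agent). $\mathrm{LTL}_f$ formulas: $\varphi::=\mathrm{true}\mid a\in\mathsf{AP}\mid\neg\varphi\mid\varphi\wedge\varphi\mid \mathsf{X}\varphi\mid\varphi\,\mathsf{U}\,\varphi$. They are interpreted over finite traces $\rho=\rho[0]\cdots\rho[m]$ with $\rho[i]\in 2^{\mathsf{AP}}$ and $|\rho|=m+1$: Boolean cases as usual; $\rho,i\models a$ iff $a\in\rho[i]$; $\rho,i\models\mathsf{X}\varphi$ iff $i+1<|\rho|$ and $\rho,i+1\models\varphi$; $\rho,i\models\varphi_1\mathsf{U}\varphi_2$ iff there is $j$ with $i\le j<|\rho|$, $\rho,j\models\varphi_2$, and $\rho,k\models\varphi_1$ for all $i\le k<j$. $\rho\models\varphi$ iff $\rho,0\models\varphi$. For each $\varphi_i\in\Phi$, let $\mathcal{G}_i=(2^{\mathcal{X}\cup\mathcal{Y}},S_i,q_i^0,\delta_i,F_i)$ be a (complete) deterministic finite automaton recognizing exactly the finite traces satisfying $\varphi_i$. The multi-property arena is the product $\mathcal{G}^\times=(2^{\mathcal{X}\cup\mathcal{Y}},S^\times,s_0^\times,\delta^\times)$ with $S^\times=S_1\times\cdots\times S_n$, $s_0^\times=(q_1^0,\dots,q_n^0)$, $\delta^\times((q_1,\dots,q_n),a)=(\delta_1(q_1,a),\dots,\delta_n(q_n,a))$.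 For $s=(q_1,\dots,q_n)\in S^\times$ and $C\subseteq\Phi$: $s\models C$ iff $q_i\in F_i$ for every $\varphi_i\in C$. A strategy is a function $g:(2^{\mathcal{X}})^*\to 2^{\mathcal{Y}}$. A goal set $C\subseteq\Phi$ is realizable from $s\in S^\times$ if there is a strategy $g$ such that for every input sequence $X_0X_1\cdots\in(2^{\mathcal{X}})^\omega$ the play $s_0:=s$, $s_{t+1}:=\delta^\times(s_t,g(X_0\cdots X_{t-1})\cup X_t)$ has some $k\ge 0$ with $s_k\models C$. Controllable multi-property predecessor: for $\mathcal{E}\subseteq S^\times\times 2^{\Phi}$, $$\mathrm{PreMC}(\mathcal{E}):=\{(s,C)\mid \exists Y\in 2^{\mathcal{Y}}\ \forall X\in 2^{\mathcal{X}}.\ (\delta^\times(s,Y\cup X),C)\in\mathcal{E}\}.$$ *)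

theory Defs
  imports Main "HOL-Library.FuncSet"
begin

datatype (atoms: 'a) ltlf =
    TrueF
  | Prop 'a
  | NotF "'a ltlf"
  | AndF "'a ltlf" "'a ltlf"
  | NextF "'a ltlf"
  | UntilF "'a ltlf" "'a ltlf"

primrec sat_at :: "'a set list \<Rightarrow> nat \<Rightarrow> 'a ltlf \<Rightarrow> bool" where
  "sat_at \<rho> i TrueF \<longleftrightarrow> True"
| "sat_at \<rho> i (Prop a) \<longleftrightarrow> a \<in> \<rho> ! i"
| "sat_at \<rho> i (NotF f) \<longleftrightarrow> \<not> sat_at \<rho> i f"
| "sat_at \<rho> i (AndF f g) \<longleftrightarrow> sat_at \<rho> i f \<and> sat_at \<rho> i g"
| "sat_at \<rho> i (NextF f) \<longleftrightarrow> i + 1 < length \<rho> \<and> sat_at \<rho> (i + 1) f"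
| "sat_at \<rho> i (UntilF f g) \<longleftrightarrow>
     (\<exists>j. i \<le> j \<and> j < length \<rho> \<and> sat_at \<rho> j g \<and> (\<forall>k. i \<le> k \<and> k < j \<longrightarrow> sat_at \<rho> k f))"

definition sat :: "'a set list \<Rightarrow> 'a ltlf \<Rightarrow> bool" where
  "sat \<rho> f \<longleftrightarrow> sat_at \<rho> 0 f"

record ('l, 's) det_ts =
  alphabet :: "'l set"
  states :: "'s set"
  initial :: 's
  trans_fun :: "'s \<Rightarrow> 'l \<Rightarrow> 's"

record ('l, 's) dfa = "('l, 's) det_ts" +
  accepting :: "'s set"

definition complete_dfa :: "('l, 's) dfa \<Rightarrow> bool" where
  "complete_dfa G \<longleftrightarrow>
     finite (alphabet G) \<and> finite (states G) \<and> initial G \<in> states G \<and>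
     (\<forall>q\<in>states G. \<forall>a\<in>alphabet G. trans_fun G q a \<in> states G) \<and>
     accepting G \<subseteq> states G"

definition dfa_accepts :: "('l, 's) dfa \<Rightarrow> 'l list \<Rightarrow> bool" where
  "dfa_accepts G w \<longleftrightarrow> foldl (trans_fun G) (initial G) w \<in> accepting G"

(* Finite traces are non-empty, so acceptance of the empty word is left unconstrained. *)
definition recognizes :: "('a set, 's) dfa \<Rightarrow> 'a ltlf \<Rightarrow> bool" where
  "recognizes G f \<longleftrightarrow>
     (\<forall>\<rho>. \<rho> \<noteq> [] \<and> set \<rho> \<subseteq> alphabet G \<longrightarrow> (dfa_accepts G \<rho> \<longleftrightarrow> sat \<rho> f))"

(* Below, X and Y are the input and output propositions, phi 1, ..., phi n the properties and
   G 1, ..., G n their automata. All automata draw their states from one type, but each has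
   its own carrier; a tuple of states is an extensional function on {1..n}. *)

definition goals :: "nat \<Rightarrow> (nat \<Rightarrow> 'a ltlf) \<Rightarrow> 'a ltlf set" where
  "goals n \<phi> = \<phi> ` {1..n}"

definition arena ::
  "'a set \<Rightarrow> 'a set \<Rightarrow> nat \<Rightarrow> (nat \<Rightarrow> ('a set, 's) dfa) \<Rightarrow> ('a set, nat \<Rightarrow> 's) det_ts" where
  "arena X Y n G =
     \<lparr> alphabet = Pow (X \<union> Y),
       states = (\<Pi>\<^sub>E i\<in>{1..n}. states (G i)),
       initial = (\<lambda>i\<in>{1..n}. initial (G i)),
       trans_fun = (\<lambda>s a. \<lambda>i\<in>{1..n}. trans_fun (G i) (s i) a) \<rparr>"

definition sat_goals ::
  "nat \<Rightarrow> (nat \<Rightarrow> 'a ltlf) \<Rightarrow> (nat \<Rightarrow> ('a set, 's) dfa) \<Rightarrow> (nat \<Rightarrow> 's) \<Rightarrow> 'a ltlf set \<Rightarrow> bool" where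
  "sat_goals n \<phi> G s C \<longleftrightarrow> (\<forall>i\<in>{1..n}. \<phi> i \<in> C \<longrightarrow> s i \<in> accepting (G i))"

primrec play ::
  "('a set, 'q) det_ts \<Rightarrow> ('a set list \<Rightarrow> 'a set) \<Rightarrow> (nat \<Rightarrow> 'a set) \<Rightarrow> 'q \<Rightarrow> nat \<Rightarrow> 'q" where
  "play A g \<xi> s 0 = s"
| "play A g \<xi> s (Suc t) = trans_fun A (play A g \<xi> s t) (g (map \<xi> [0..<t]) \<union> \<xi> t)"

definition strategies :: "'a set \<Rightarrow> 'a set \<Rightarrow> ('a set list \<Rightarrow> 'a set) set" where
  "strategies X Y = lists (Pow X) \<rightarrow> Pow Y"

definition realizable ::
  "'a set \<Rightarrow> 'a set \<Rightarrow> nat \<Rightarrow> (nat \<Rightarrow> 'a ltlf) \<Rightarrow> (nat \<Rightarrow> ('a set, 's) dfa) \<Rightarrow>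
   (nat \<Rightarrow> 's) \<Rightarrow> 'a ltlf set \<Rightarrow> bool" where
  "realizable X Y n \<phi> G s C \<longleftrightarrow>
     (\<exists>g\<in>strategies X Y. \<forall>\<xi>. (\<forall>t. \<xi> t \<in> Pow X) \<longrightarrow>
        (\<exists>k. sat_goals n \<phi> G (play (arena X Y n G) g \<xi> s k) C))"

definition PreMC ::
  "'a set \<Rightarrow> 'a set \<Rightarrow> nat \<Rightarrow> (nat \<Rightarrow> 'a ltlf) \<Rightarrow> (nat \<Rightarrow> ('a set, 's) dfa) \<Rightarrow>
   ((nat \<Rightarrow> 's) \<times> 'a ltlf set) set \<Rightarrow> ((nat \<Rightarrow> 's) \<times> 'a ltlf set) set" where
  "PreMC X Y n \<phi> G E =
     {(s, C). s \<in> states (arena X Y n G) \<and> C \<in> Pow (goals n \<phi>) \<and>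
        (\<exists>Y'\<in>Pow Y. \<forall>X'\<in>Pow X. (trans_fun (arena X Y n G) s (Y' \<union> X'), C) \<in> E)}"

primrec WinM_iter ::
  "'a set \<Rightarrow> 'a set \<Rightarrow> nat \<Rightarrow> (nat \<Rightarrow> 'a ltlf) \<Rightarrow> (nat \<Rightarrow> ('a set, 's) dfa) \<Rightarrow> nat \<Rightarrow>
   ((nat \<Rightarrow> 's) \<times> 'a ltlf set) set" where
  "WinM_iter X Y n \<phi> G 0 =
     {(s, C). s \<in> states (arena X Y n G) \<and> C \<in> Pow (goals n \<phi>) \<and> sat_goals n \<phi> G s C}"
| "WinM_iter X Y n \<phi> G (Suc i) = WinM_iter X Y n \<phi> G i \<union> PreMC X Y n \<phi> G (WinM_iter X Y n \<phi> G i)"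

definition WinM ::
  "'a set \<Rightarrow> 'a set \<Rightarrow> nat \<Rightarrow> (nat \<Rightarrow> 'a ltlf) \<Rightarrow> (nat \<Rightarrow> ('a set, 's) dfa) \<Rightarrow>
   ((nat \<Rightarrow> 's) \<times> 'a ltlf set) set" where
  "WinM X Y n \<phi> G = (\<Union>i. WinM_iter X Y n \<phi> G i)"

end

(* A winning strategy from a state that enters WinM at stage i+1 plays the output witnessing
   membership in PreMC and then, depending on the first input, a strategy for the successor.
   Conversely, as there are finitely many inputs, WinM is closed under PreMC, so outside WinM
   the environment can answer every output by an input that keeps the play outside WinM. *)

theory Submission
  imports Defs
begin

text \<open>\<open>play\<close> is defined by appending a last step. Peeling off the first step
  instead leaves a residual strategy that still remembers the first input, which is what gluing
  strategies of successors requires.\<close>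

lemma play_Suc_shift:
  "play A g \<xi> s (Suc t) =
     play A (\<lambda>w. g (\<xi> 0 # w)) (\<lambda>i. \<xi> (Suc i)) (trans_fun A s (g [] \<union> \<xi> 0)) t"
proof (induction t)
  case 0
  then show ?case by simp
next
  case (Suc t)
  have "map \<xi> [0..<Suc t] = \<xi> 0 # map (\<lambda>i. \<xi> (Suc i)) [0..<t]"
    by (rule map_upt_Suc)
  with Suc.IH show ?case
    by (simp del: upt_Suc)
qed

lemma trans_fun_arena_in_states:
  assumes "\<And>i. i \<in> {1..n} \<Longrightarrow> alphabet (G i) = Pow (X \<union> Y)"
    and "\<And>i. i \<in> {1..n} \<Longrightarrow> complete_dfa (G i)"
    and "s \<in> states (arena X Y n G)" and "a \<subseteq> X \<union> Y"
  shows "trans_fun (arena X Y n G) s a \<in> states (arena X Y n G)"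
  using assms by (auto simp: arena_def complete_dfa_def PiE_iff)

lemma realizable_if_sat_goals:
  assumes "sat_goals n \<phi> G s C"
  shows "realizable X Y n \<phi> G s C"
  unfolding realizable_def
proof (intro bexI allI impI exI)
  show "sat_goals n \<phi> G (play (arena X Y n G) (\<lambda>_. {}) \<xi> s 0) C" for \<xi>
    using assms by simp
qed (simp add: strategies_def)

lemma realizable_if_successors_realizable:
  assumes Y': "Y' \<subseteq> Y"
    and succ: "\<And>X'. X' \<subseteq> X \<Longrightarrow>
      realizable X Y n \<phi> G (trans_fun (arena X Y n G) s (Y' \<union> X')) C"
  shows "realizable X Y n \<phi> G s C"
proof -
  let ?A = "arena X Y n G"
  \<comment> \<open>One winning strategy is chosen per first input; \<open>h\<close> is constrained
    only on subsets of \<open>X\<close>, where all heads of admissible histories lie.\<close>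
  obtain h where h: "\<And>X'. X' \<subseteq> X \<Longrightarrow> h X' \<in> strategies X Y"
    and win: "\<And>X' \<xi>. X' \<subseteq> X \<Longrightarrow> (\<forall>t. \<xi> t \<in> Pow X) \<Longrightarrow>
      \<exists>k. sat_goals n \<phi> G (play ?A (h X') \<xi> (trans_fun ?A s (Y' \<union> X')) k) C"
    using succ unfolding realizable_def by metis
  define g where "g w = (case w of [] \<Rightarrow> Y' | x # xs \<Rightarrow> h x xs)" for w
  have "g \<in> strategies X Y"
    unfolding strategies_def
  proof
    fix w assume "w \<in> lists (Pow X)"
    then show "g w \<in> Pow Y"
      using Y' h by (cases w) (auto simp: g_def strategies_def Pi_iff)
  qed
  moreover have "\<exists>k. sat_goals n \<phi> G (play ?A g \<xi> s k) C" if \<xi>: "\<forall>t. \<xi> t \<in> Pow X" for \<xi>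
  proof -
    obtain k where
      "sat_goals n \<phi> G (play ?A (h (\<xi> 0)) (\<lambda>i. \<xi> (Suc i)) (trans_fun ?A s (Y' \<union> \<xi> 0)) k) C"
      using win[of "\<xi> 0" "\<lambda>i. \<xi> (Suc i)"] \<xi> by blast
    \<comment> \<open>After the first input, \<open>g\<close> agrees with \<open>h (\<xi> 0)\<close>
      on the remaining history, so the goal is met one step later than from the successor.\<close>
    then have "sat_goals n \<phi> G (play ?A g \<xi> s (Suc k)) C"
      unfolding play_Suc_shift by (simp add: g_def)
    then show ?thesis ..
  qed
  ultimately show ?thesis
    unfolding realizable_def by blast
qed

lemma realizable_if_WinM_iter:
  "(s, C) \<in> WinM_iter X Y n \<phi> G i \<Longrightarrow> realizable X Y n \<phi> G s C"
proof (induction i arbitrary: s)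
  case 0
  then show ?case by (simp add: realizable_if_sat_goals)
next
  case (Suc i)
  show ?case
  proof (cases "(s, C) \<in> WinM_iter X Y n \<phi> G i")
    case True
    then show ?thesis by (rule Suc.IH)
  next
    case False
    with Suc.prems obtain Y' where "Y' \<subseteq> Y"
      and "\<forall>X'\<in>Pow X. (trans_fun (arena X Y n G) s (Y' \<union> X'), C) \<in> WinM_iter X Y n \<phi> G i"
      by (auto simp: PreMC_def)
    with Suc.IH show ?thesis
      by (blast intro: realizable_if_successors_realizable)
  qed
qed

lemma mono_WinM_iter: "mono (WinM_iter X Y n \<phi> G)"
  by (simp add: mono_iff_le_Suc)

lemma PreMC_WinM_subset:
  assumes "finite X"
  shows "PreMC X Y n \<phi> G (WinM X Y n \<phi> G) \<subseteq> WinM X Y n \<phi> G"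
proof clarify
  fix s C assume pre: "(s, C) \<in> PreMC X Y n \<phi> G (WinM X Y n \<phi> G)"
  let ?succ = "\<lambda>Y' X'. (trans_fun (arena X Y n G) s (Y' \<union> X'), C)"
  obtain Y' where Y': "Y' \<in> Pow Y" "\<forall>X'\<in>Pow X. \<exists>i. ?succ Y' X' \<in> WinM_iter X Y n \<phi> G i"
    using pre by (auto simp: PreMC_def WinM_def)
  then obtain stage where stage: "\<forall>X'\<in>Pow X. ?succ Y' X' \<in> WinM_iter X Y n \<phi> G (stage X')"
    by metis
  \<comment> \<open>The stages are cumulative, so their maximum over the finite, nonempty set
    \<open>Pow X\<close> serves all inputs at once. This is where finiteness of \<open>X\<close>
    enters.\<close>
  define m where "m = Max (stage ` Pow X)"
  have "?succ Y' X' \<in> WinM_iter X Y n \<phi> G m" if "X' \<in> Pow X" for X'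
  proof -
    have "stage X' \<le> m"
      using that assms by (auto simp: m_def)
    then show ?thesis
      using stage that monoD[OF mono_WinM_iter] by blast
  qed
  then have "(s, C) \<in> PreMC X Y n \<phi> G (WinM_iter X Y n \<phi> G m)"
    using pre Y'(1) by (auto simp: PreMC_def)
  then have "(s, C) \<in> WinM_iter X Y n \<phi> G (Suc m)"
    by simp
  then show "(s, C) \<in> WinM X Y n \<phi> G"
    unfolding WinM_def by blast
qed

text \<open>The environment's answer to a fixed strategy \<open>g\<close>. Arena membership is
  carried along because stage 0 of \<open>WinM\<close> contains only arena states: it turns any goal
  state on this play into an element of \<open>WinM\<close>.\<close>

lemma play_avoiding_WinM:
  assumes "finite X"
    and alph: "\<And>i. i \<in> {1..n} \<Longrightarrow> alphabet (G i) = Pow (X \<union> Y)"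
    and compl: "\<And>i. i \<in> {1..n} \<Longrightarrow> complete_dfa (G i)"
    and s: "s \<in> states (arena X Y n G)" and C: "C \<subseteq> goals n \<phi>"
    and notin: "(s, C) \<notin> WinM X Y n \<phi> G" and g: "g \<in> strategies X Y"
  obtains \<xi> where "\<And>t. \<xi> t \<in> Pow X"
    and "\<And>t. play (arena X Y n G) g \<xi> s t \<in> states (arena X Y n G)"
    and "\<And>t. (play (arena X Y n G) g \<xi> s t, C) \<notin> WinM X Y n \<phi> G"
proof -
  let ?A = "arena X Y n G" and ?W = "WinM X Y n \<phi> G"
  \<comment> \<open>The input depends on the past, so the states are chosen together with the input history.\<close>
  define P where
    "P = (\<lambda>(q, w). q \<in> states ?A \<and> (q, C) \<notin> ?W \<and> w \<in> lists (Pow X))"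
  define R where
    "R = (\<lambda>(q, w) (q', w'). \<exists>x\<in>Pow X. w' = w @ [x] \<and> q' = trans_fun ?A q (g w \<union> x))"
  have "\<exists>p'. P p' \<and> R p p'" if "P p" for p
  proof -
    obtain q w where p: "p = (q, w)" by fastforce
    with that have q: "q \<in> states ?A" "(q, C) \<notin> ?W" and w: "w \<in> lists (Pow X)"
      by (auto simp: P_def)
    have gw: "g w \<in> Pow Y"
      using g w by (auto simp: strategies_def)
    have "(q, C) \<notin> PreMC X Y n \<phi> G ?W"
      using q PreMC_WinM_subset[OF \<open>finite X\<close>] by blast
    \<comment> \<open>As \<open>q\<close> is an arena state and \<open>C\<close> a goal set, failure
      to be in \<open>PreMC\<close> means that every output, in particular \<open>g w\<close>,
      admits a bad input.\<close>
    then obtain x where x: "x \<in> Pow X" "(trans_fun ?A q (g w \<union> x), C) \<notin> ?W"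
      using q C gw unfolding PreMC_def by blast
    moreover have "trans_fun ?A q (g w \<union> x) \<in> states ?A"
      using q gw x by (intro trans_fun_arena_in_states alph compl) auto
    ultimately have "P (trans_fun ?A q (g w \<union> x), w @ [x])" "R p (trans_fun ?A q (g w \<union> x), w @ [x])"
      using w by (auto simp: P_def R_def p)
    then show ?thesis by blast
  qed
  moreover have "P (s, [])"
    using s notin by (simp add: P_def)
  \<comment> \<open>Dependent choice does not fix the first element by itself; the conjunct for
    \<open>t = 0\<close> pins it to \<open>(s, [])\<close>.\<close>
  ultimately obtain f where f: "f 0 = (s, [])" "\<And>t. P (f t)" "\<And>t. R (f t) (f (Suc t))"
    using dependent_nat_choice[of "\<lambda>t p. P p \<and> (t = 0 \<longrightarrow> p = (s, []))" "\<lambda>_. R"] by auto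
  \<comment> \<open>\<open>R\<close> appends one input per round, so the input of round
    \<open>t\<close> is the last entry of the history at \<open>Suc t\<close>.\<close>
  define \<xi> where "\<xi> t = last (snd (f (Suc t)))" for t
  have step: "\<xi> t \<in> Pow X" "snd (f (Suc t)) = snd (f t) @ [\<xi> t]"
    "fst (f (Suc t)) = trans_fun ?A (fst (f t)) (g (snd (f t)) \<union> \<xi> t)" for t
    using f(3)[of t] by (auto simp: R_def \<xi>_def split: prod.splits)
  \<comment> \<open>Once the stored history is the prefix of \<open>\<xi>\<close> of length
    \<open>t\<close>, the outputs used in \<open>f\<close> are those of \<open>play\<close>, and the
    chosen states form the play itself.\<close>
  have history: "snd (f t) = map \<xi> [0..<t]" for t
    by (induction t) (simp_all add: f(1) step(2))
  have "play ?A g \<xi> s t = fst (f t)" for t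
    by (induction t) (simp_all add: f(1) step(3) history)
  then show thesis
    using that[of \<xi>] step(1) f(2) by (auto simp: P_def split_beta)
qed

theorem theorem1:
  fixes X Y :: "'a set"
    and n :: nat
    and \<phi> :: "nat \<Rightarrow> 'a ltlf"
    and G :: "nat \<Rightarrow> ('a set, 's) dfa"
  assumes "finite X" and "finite Y" and "X \<inter> Y = {}"
    and "\<And>i. i \<in> {1..n} \<Longrightarrow> atoms (\<phi> i) \<subseteq> X \<union> Y"
    and "\<And>i. i \<in> {1..n} \<Longrightarrow> alphabet (G i) = Pow (X \<union> Y)"
    and "\<And>i. i \<in> {1..n} \<Longrightarrow> complete_dfa (G i)"
    and "\<And>i. i \<in> {1..n} \<Longrightarrow> recognizes (G i) (\<phi> i)"
  shows "\<forall>s\<in>states (arena X Y n G). \<forall>C. C \<subseteq> goals n \<phi> \<longrightarrow>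
           ((s, C) \<in> WinM X Y n \<phi> G \<longleftrightarrow> realizable X Y n \<phi> G s C)"
proof (intro ballI allI impI iffI)
  fix s C assume "(s, C) \<in> WinM X Y n \<phi> G"
  then show "realizable X Y n \<phi> G s C"
    by (auto simp: WinM_def intro: realizable_if_WinM_iter)
next
  fix s C
  assume s: "s \<in> states (arena X Y n G)" and C: "C \<subseteq> goals n \<phi>"
    and "realizable X Y n \<phi> G s C"
  then obtain g where g: "g \<in> strategies X Y"
    and win: "\<And>\<xi>. (\<forall>t. \<xi> t \<in> Pow X) \<Longrightarrow>
      \<exists>k. sat_goals n \<phi> G (play (arena X Y n G) g \<xi> s k) C"
    unfolding realizable_def by blast
  show "(s, C) \<in> WinM X Y n \<phi> G"
  proof (rule ccontr)
    assume "(s, C) \<notin> WinM X Y n \<phi> G"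
    then obtain \<xi> where \<xi>: "\<And>t. \<xi> t \<in> Pow X"
      and "\<And>t. play (arena X Y n G) g \<xi> s t \<in> states (arena X Y n G)"
      and "\<And>t. (play (arena X Y n G) g \<xi> s t, C) \<notin> WinM X Y n \<phi> G"
      using play_avoiding_WinM[OF assms(1,5,6) s C _ g] by blast
    moreover obtain k where "sat_goals n \<phi> G (play (arena X Y n G) g \<xi> s k) C"
      using win \<xi> by blast
    ultimately have "(play (arena X Y n G) g \<xi> s k, C) \<in> WinM_iter X Y n \<phi> G 0"
      using C by simp
    then have "(play (arena X Y n G) g \<xi> s k, C) \<in> WinM X Y n \<phi> G"
      unfolding WinM_def by blast
    with \<open>\<And>t. (play (arena X Y n G) g \<xi> s t, C) \<notin> WinM X Y n \<phi> G\<close> show False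
      by blast
  qed
qed

end
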